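(* Let $A$ be a $\mathcal{{}^KOCA}$ (Krivine ordered combinatory algebra), and let $$\rho:P\to J,\quad \pi:P\to K,\quad \alpha:J\to I,\quad \beta:K\to I$$ be functions forming a pullback square in the category of sets ($\alpha\rho=\beta\pi$, with $P$ the pullback of $\alpha$ and $\beta$). Then for all $\varphi\in A^J$: $$\beta^*(\forall_A\alpha(\varphi))\vdash\forall_A\pi(\rho^*(\varphi))\quad\text{and}\quad\forall_A\pi(\rho^*(\varphi))\vdash\beta^*(\forall_A\alpha(\varphi)).$$
   Context: An ordered combinatory algebra (OCA) is $(A,\circ,\le,\mathrm k,\mathrm s)$ with $A$ a set, $\circ:A\times A\to A$ a binary operation (application, $a\circ b=ab$, associating to the left), $\le$ a partial order on $A$, and $\mathrm k,\mathrm s\in A$, such that application is monotone in both arguments and $\mathrm kab\le a$, $\mathrm sabc\le ac(bc)$ for all $a,b,c\in A$. An implication is a map $\to:A\times A\to A$, monotone in the second variable and antimonotone in the first, such that $a\le(b\to c)$ implies $ab\le c$. An adjunctor is an element $\mathrm e\in A$ such that $ab\le c$ implies $\mathrm ea\le(b\to c)$. The OCA is classic if there is $\mathrm c\in A$ with $\mathrm c\le(((a\to b)\to a)\to a)$ for all $a,b$. A filter is a subset $\Phi\subseteq A$ closed under application, containing $\mathrm k$ and $\mathrm s$, containing $\mathrm e$ (when $A$ has an adjunctor $\mathrm e$), and containing $\mathrm c$ if $A$ is classic. A $\mathcal{{}^KOCA}$ is an OCA equipped with an implication $\to$, an adjunctor $\mathrm e$ and a filter $\Phi$, which is inf-complete: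 every subset $X\subseteq A$ has an infimum $\inf(X)\in A$ with respect to $\le$. Put $\perp=\inf A$ and $\mathrm i=\mathrm{skk}$. For a set $I$, define $\mathrm{eq}_I:I\times I\to A$ by $\mathrm{eq}_I(i,j)=\mathrm i$ if $i=j$ and $\mathrm{eq}_I(i,j)=\perp$ if $i\ne j$. $A^I$ is the set of functions $I\to A$; $\varphi\vdash\psi$ on $A^I$ means that there is $f\in\Phi$ with $f\varphi(i)\le\psi(i)$ for all $i\in I$. For any function $\alpha:J\to I$, $\alpha^*:A^I\to A^J$ is $\alpha^*(\psi)=\psi\circ\alpha$ (composition of functions), and for $\varphi\in A^J$, $\forall_A\alpha(\varphi)\in A^I$ is $\forall_A\alpha(\varphi)(i)=\inf_{j\in J}\{\mathrm{eq}_I(\alpha(j),i)\to\varphi(j)\}$ (and similarly for $\beta,\rho,\pi$). *)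

theory Defs
  imports "HOL-Library.FuncSet" "HOL-Library.Lub_Glb"
begin

section \<open>Ordered combinatory algebras\<close>

text \<open>The underlying set of an algebra is nonempty (it contains \<open>k\<close>), so it is taken to be a
  type, with its partial order supplied by the class \<^class>\<open>order\<close>. Index sets, in contrast, may be
  empty and are sets inside a type.\<close>

locale oca =
  fixes app :: "'a::order \<Rightarrow> 'a \<Rightarrow> 'a"  (infixl "\<cdot>" 70)
    and k s :: 'a
  assumes app_mono: "a \<le> a' \<Longrightarrow> b \<le> b' \<Longrightarrow> a \<cdot> b \<le> a' \<cdot> b'"
    and k_le: "k \<cdot> a \<cdot> b \<le> a"
    and s_le: "s \<cdot> a \<cdot> b \<cdot> c \<le> a \<cdot> c \<cdot> (b \<cdot> c)"

definition is_implication :: "('a::order \<Rightarrow> 'a \<Rightarrow> 'a) \<Rightarrow> ('a \<Rightarrow> 'a \<Rightarrow> 'a) \<Rightarrow> bool" where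
  "is_implication app imp \<longleftrightarrow>
     (\<forall>a b b'. b \<le> b' \<longrightarrow> imp a b \<le> imp a b') \<and>
     (\<forall>a a' b. a \<le> a' \<longrightarrow> imp a' b \<le> imp a b) \<and>
     (\<forall>a b c. a \<le> imp b c \<longrightarrow> app a b \<le> c)"

definition is_adjunctor ::
  "('a::order \<Rightarrow> 'a \<Rightarrow> 'a) \<Rightarrow> ('a \<Rightarrow> 'a \<Rightarrow> 'a) \<Rightarrow> 'a \<Rightarrow> bool" where
  "is_adjunctor app imp e \<longleftrightarrow> (\<forall>a b c. app a b \<le> c \<longrightarrow> app e a \<le> imp b c)"

definition is_classic_element :: "('a::order \<Rightarrow> 'a \<Rightarrow> 'a) \<Rightarrow> 'a \<Rightarrow> bool" where
  "is_classic_element imp c \<longleftrightarrow> (\<forall>a b. c \<le> imp (imp (imp a b) a) a)"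

definition is_classic :: "('a::order \<Rightarrow> 'a \<Rightarrow> 'a) \<Rightarrow> bool" where
  "is_classic imp \<longleftrightarrow> (\<exists>c. is_classic_element imp c)"

text \<open>The adjunctor \<open>e\<close> is part of the structure, whereas being classic is a mere existence
  property; for a classic algebra, a filter is required to contain one of the elements
  witnessing it.\<close>

definition is_oca_filter ::
  "('a::order \<Rightarrow> 'a \<Rightarrow> 'a) \<Rightarrow> 'a \<Rightarrow> 'a \<Rightarrow> ('a \<Rightarrow> 'a \<Rightarrow> 'a) \<Rightarrow> 'a \<Rightarrow> 'a set \<Rightarrow> bool" where
  "is_oca_filter app k s imp e \<Phi> \<longleftrightarrow>
     (\<forall>a\<in>\<Phi>. \<forall>b\<in>\<Phi>. app a b \<in> \<Phi>) \<and> k \<in> \<Phi> \<and> s \<in> \<Phi> \<and> e \<in> \<Phi> \<and>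
     (is_classic imp \<longrightarrow> (\<exists>c\<in>\<Phi>. is_classic_element imp c))"

locale koca = oca app k s
  for app :: "'a::order \<Rightarrow> 'a \<Rightarrow> 'a"  (infixl "\<cdot>" 70) and k s :: 'a +
  fixes imp :: "'a \<Rightarrow> 'a \<Rightarrow> 'a"
    and e :: 'a
    and \<Phi> :: "'a set"
  assumes implication: "is_implication app imp"
    and adjunctor: "is_adjunctor app imp e"
    and filter: "is_oca_filter app k s imp e \<Phi>"
    and inf_complete: "\<exists>m. isGlb UNIV (X :: 'a set) m"

text \<open>Only meaningful when \<open>X\<close> has a greatest lower bound, as it always does in a \<^locale>\<open>koca\<close>.\<close>

definition infimum :: "'a::order set \<Rightarrow> 'a" where
  "infimum X = (THE m. isGlb UNIV X m)"

lemma (in koca) isGlb_infimum: "isGlb UNIV (X :: 'a set) (infimum X)"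
proof -
  obtain m where m: "isGlb UNIV X m"
    using inf_complete by blast
  show ?thesis
    unfolding infimum_def using m by (rule theI)
      (use m in \<open>auto simp: isGlb_def greatestP_def isLb_def setle_def intro: order.antisym\<close>)
qed


section \<open>The indexed preorder of an algebra\<close>

text \<open>The set of functions from \<open>I\<close> to \<open>A\<close> is \<open>I \<rightarrow>\<^sub>E UNIV\<close>.\<close>

definition entails ::
  "('a::order \<Rightarrow> 'a \<Rightarrow> 'a) \<Rightarrow> 'a set \<Rightarrow> 'i set \<Rightarrow> ('i \<Rightarrow> 'a) \<Rightarrow> ('i \<Rightarrow> 'a) \<Rightarrow> bool" where
  "entails app \<Phi> I \<phi> \<psi> \<longleftrightarrow> (\<exists>f\<in>\<Phi>. \<forall>i\<in>I. app f (\<phi> i) \<le> \<psi> i)"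

definition reindex :: "'j set \<Rightarrow> ('j \<Rightarrow> 'i) \<Rightarrow> ('i \<Rightarrow> 'a) \<Rightarrow> 'j \<Rightarrow> 'a" where
  "reindex J \<alpha> \<psi> = compose J \<psi> \<alpha>"

definition eqA :: "('a::order \<Rightarrow> 'a \<Rightarrow> 'a) \<Rightarrow> 'a \<Rightarrow> 'a \<Rightarrow> 'i \<Rightarrow> 'i \<Rightarrow> 'a" where
  "eqA app k s i j = (if i = j then app (app s k) k else infimum UNIV)"

definition forallA ::
  "('a::order \<Rightarrow> 'a \<Rightarrow> 'a) \<Rightarrow> 'a \<Rightarrow> 'a \<Rightarrow> ('a \<Rightarrow> 'a \<Rightarrow> 'a) \<Rightarrow> 'j set \<Rightarrow> 'i set \<Rightarrow> ('j \<Rightarrow> 'i)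
     \<Rightarrow> ('j \<Rightarrow> 'a) \<Rightarrow> 'i \<Rightarrow> 'a" where
  "forallA app k s imp J I \<alpha> \<phi> =
     (\<lambda>i\<in>I. infimum {imp (eqA app k s (\<alpha> j) i) (\<phi> j) | j. j \<in> J})"


section \<open>Pullback squares of sets\<close>

text \<open>The universal property of the square
  \<open>\<rho> : P \<rightarrow> J\<close>, \<open>\<pi> : P \<rightarrow> K\<close>, \<open>\<alpha> : J \<rightarrow> I\<close>, \<open>\<beta> : K \<rightarrow> I\<close> in the category of sets. The test objects
  \<open>T\<close> range over the sets of elements of a type \<open>'t\<close>, since HOL cannot quantify over all
  types at once; the choice of \<open>'t\<close> does not matter, by the lemma below.\<close>

definition is_pullback ::
  "'t itself \<Rightarrow> 'p set \<Rightarrow> 'j set \<Rightarrow> 'k set \<Rightarrow> 'i set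
     \<Rightarrow> ('p \<Rightarrow> 'j) \<Rightarrow> ('p \<Rightarrow> 'k) \<Rightarrow> ('j \<Rightarrow> 'i) \<Rightarrow> ('k \<Rightarrow> 'i) \<Rightarrow> bool" where
  "is_pullback (_ :: 't itself) P J K I \<rho> \<pi> \<alpha> \<beta> \<longleftrightarrow>
     \<rho> \<in> P \<rightarrow>\<^sub>E J \<and> \<pi> \<in> P \<rightarrow>\<^sub>E K \<and> \<alpha> \<in> J \<rightarrow>\<^sub>E I \<and> \<beta> \<in> K \<rightarrow>\<^sub>E I \<and>
     compose P \<alpha> \<rho> = compose P \<beta> \<pi> \<and>
     (\<forall>(T :: 't set) f g. f \<in> T \<rightarrow>\<^sub>E J \<and> g \<in> T \<rightarrow>\<^sub>E K \<and> compose T \<alpha> f = compose T \<beta> g \<longrightarrow>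
        (\<exists>!h. h \<in> T \<rightarrow>\<^sub>E P \<and> compose T \<rho> h = f \<and> compose T \<pi> h = g))"

lemma compose_eq_iff: "compose T f g = compose T f' g' \<longleftrightarrow> (\<forall>t\<in>T. f (g t) = f' (g' t))"
  by (auto simp: compose_def restrict_def fun_eq_iff)

lemma compose_eq_PiE_iff:
  "f \<in> T \<rightarrow>\<^sub>E J \<Longrightarrow> compose T r h = f \<longleftrightarrow> (\<forall>t\<in>T. r (h t) = f t)"
  by (auto simp: compose_def restrict_def fun_eq_iff PiE_def extensional_def)

lemma is_pullback_iff_fibre_product:
  "is_pullback TYPE('t) P J K I \<rho> \<pi> \<alpha> \<beta> \<longleftrightarrow>
     \<rho> \<in> P \<rightarrow>\<^sub>E J \<and> \<pi> \<in> P \<rightarrow>\<^sub>E K \<and> \<alpha> \<in> J \<rightarrow>\<^sub>E I \<and> \<beta> \<in> K \<rightarrow>\<^sub>E I \<and>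
     bij_betw (\<lambda>p. (\<rho> p, \<pi> p)) P {(j, l). j \<in> J \<and> l \<in> K \<and> \<alpha> j = \<beta> l}"
  (is "?L \<longleftrightarrow> ?R")
proof
  assume L: ?L
  from L have maps: "\<rho> \<in> P \<rightarrow>\<^sub>E J" "\<pi> \<in> P \<rightarrow>\<^sub>E K" "\<alpha> \<in> J \<rightarrow>\<^sub>E I" "\<beta> \<in> K \<rightarrow>\<^sub>E I"
    and sq: "compose P \<alpha> \<rho> = compose P \<beta> \<pi>"
    and univ: "\<And>(T :: 't set) f g.
      f \<in> T \<rightarrow>\<^sub>E J \<Longrightarrow> g \<in> T \<rightarrow>\<^sub>E K \<Longrightarrow> compose T \<alpha> f = compose T \<beta> g \<Longrightarrow>
      \<exists>!h. h \<in> T \<rightarrow>\<^sub>E P \<and> compose T \<rho> h = f \<and> compose T \<pi> h = g"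
    unfolding is_pullback_def by simp_all
  have comm: "\<alpha> (\<rho> p) = \<beta> (\<pi> p)" if "p \<in> P" for p
    using sq that by (simp add: compose_eq_iff)
  have ex1: "\<exists>!p. p \<in> P \<and> \<rho> p = j \<and> \<pi> p = l" if jl: "j \<in> J" "l \<in> K" "\<alpha> j = \<beta> l" for j l
  proof -
    let ?T = "{undefined :: 't}"
    let ?c = "\<lambda>x. (\<lambda>t\<in>?T. x)"
    have f: "?c j \<in> ?T \<rightarrow>\<^sub>E J" and g: "?c l \<in> ?T \<rightarrow>\<^sub>E K"
      using jl by auto
    have "compose ?T \<alpha> (?c j) = compose ?T \<beta> (?c l)"
      using jl by (simp add: compose_eq_iff)
    then have "\<exists>!h. h \<in> ?T \<rightarrow>\<^sub>E P \<and> compose ?T \<rho> h = ?c j \<and> compose ?T \<pi> h = ?c l"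
      by (rule univ[OF f g])
    then obtain h where h: "h \<in> ?T \<rightarrow>\<^sub>E P" "compose ?T \<rho> h = ?c j" "compose ?T \<pi> h = ?c l"
      and uniq: "\<And>h'. h' \<in> ?T \<rightarrow>\<^sub>E P \<Longrightarrow> compose ?T \<rho> h' = ?c j \<Longrightarrow> compose ?T \<pi> h' = ?c l \<Longrightarrow> h' = h"
      by (elim ex1E conjE) iprover
    show ?thesis
    proof (rule ex1I)
      show "h undefined \<in> P \<and> \<rho> (h undefined) = j \<and> \<pi> (h undefined) = l"
        using PiE_mem[OF h(1), of undefined] fun_cong[OF h(2), of undefined] fun_cong[OF h(3), of undefined]
        by (simp add: compose_def)
    next
      fix p
      assume p: "p \<in> P \<and> \<rho> p = j \<and> \<pi> p = l"
      have "?c p = h"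
        using p by (intro uniq) (simp_all add: compose_eq_PiE_iff[OF f] compose_eq_PiE_iff[OF g])
      from fun_cong[OF this, of undefined] show "p = h undefined"
        by simp
    qed
  qed
  have "inj_on (\<lambda>p. (\<rho> p, \<pi> p)) P"
  proof (rule inj_onI)
    fix p q
    assume p: "p \<in> P" and q: "q \<in> P" and "(\<rho> p, \<pi> p) = (\<rho> q, \<pi> q)"
    moreover have "\<exists>!p'. p' \<in> P \<and> \<rho> p' = \<rho> p \<and> \<pi> p' = \<pi> p"
      by (rule ex1[OF PiE_mem[OF maps(1) p] PiE_mem[OF maps(2) p] comm[OF p]])
    ultimately show "p = q"
      by (metis prod.inject)
  qed
  moreover have "(\<lambda>p. (\<rho> p, \<pi> p)) ` P = {(j, l). j \<in> J \<and> l \<in> K \<and> \<alpha> j = \<beta> l}"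
  proof (intro equalityI subsetI)
    fix x
    assume "x \<in> (\<lambda>p. (\<rho> p, \<pi> p)) ` P"
    then show "x \<in> {(j, l). j \<in> J \<and> l \<in> K \<and> \<alpha> j = \<beta> l}"
      using PiE_mem[OF maps(1)] PiE_mem[OF maps(2)] comm by auto
  next
    fix x
    assume "x \<in> {(j, l). j \<in> J \<and> l \<in> K \<and> \<alpha> j = \<beta> l}"
    then obtain j l where x: "x = (j, l)" and jl: "j \<in> J" "l \<in> K" "\<alpha> j = \<beta> l"
      by blast
    from ex1[OF jl] obtain p where "p \<in> P" "\<rho> p = j" "\<pi> p = l"
      by blast
    then show "x \<in> (\<lambda>p. (\<rho> p, \<pi> p)) ` P"
      unfolding x by blast
  qed
  ultimately show ?R
    using maps by (simp add: bij_betw_def)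
next
  assume R: ?R
  then have inj: "inj_on (\<lambda>p. (\<rho> p, \<pi> p)) P"
    and img: "(\<lambda>p. (\<rho> p, \<pi> p)) ` P = {(j, l). j \<in> J \<and> l \<in> K \<and> \<alpha> j = \<beta> l}"
    by (auto simp: bij_betw_def)
  have comm: "\<alpha> (\<rho> p) = \<beta> (\<pi> p)" if "p \<in> P" for p
    using img that by blast
  have "\<exists>!h. h \<in> T \<rightarrow>\<^sub>E P \<and> compose T \<rho> h = f \<and> compose T \<pi> h = g"
    if f: "f \<in> T \<rightarrow>\<^sub>E J" and g: "g \<in> T \<rightarrow>\<^sub>E K" and fg: "compose T \<alpha> f = compose T \<beta> g"
    for T :: "'t set" and f g
    unfolding compose_eq_PiE_iff[OF f] compose_eq_PiE_iff[OF g]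
  proof (rule ex_ex1I)
    have "\<exists>p. p \<in> P \<and> \<rho> p = f t \<and> \<pi> p = g t" if "t \<in> T" for t
    proof -
      have "(f t, g t) \<in> (\<lambda>p. (\<rho> p, \<pi> p)) ` P"
        using f g fg that unfolding img by (auto simp: compose_eq_iff)
      then show ?thesis by force
    qed
    then obtain h where "\<And>t. t \<in> T \<Longrightarrow> h t \<in> P \<and> \<rho> (h t) = f t \<and> \<pi> (h t) = g t"
      by metis
    then show "\<exists>h. h \<in> T \<rightarrow>\<^sub>E P \<and> (\<forall>t\<in>T. \<rho> (h t) = f t) \<and> (\<forall>t\<in>T. \<pi> (h t) = g t)"
      by (intro exI[of _ "restrict h T"]) auto
  next
    fix h h'
    assume h: "h \<in> T \<rightarrow>\<^sub>E P \<and> (\<forall>t\<in>T. \<rho> (h t) = f t) \<and> (\<forall>t\<in>T. \<pi> (h t) = g t)"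
      and h': "h' \<in> T \<rightarrow>\<^sub>E P \<and> (\<forall>t\<in>T. \<rho> (h' t) = f t) \<and> (\<forall>t\<in>T. \<pi> (h' t) = g t)"
    show "h = h'"
    proof (rule PiE_ext)
      show "h \<in> T \<rightarrow>\<^sub>E P" "h' \<in> T \<rightarrow>\<^sub>E P"
        using h h' by auto
      show "h t = h' t" if "t \<in> T" for t
        using h h' that by (intro inj_onD[OF inj]) auto
    qed
  qed
  then show ?L
    using R comm unfolding is_pullback_def by (simp add: compose_eq_iff)
qed

end

theory Submission
  imports Defs
begin

text \<open>
  At a point \<open>l\<close> of \<open>K\<close> the two predicates are infima of implications: on the left over all \<open>j\<close>
  in \<open>J\<close>, guarded by the equality of \<open>\<alpha> j\<close> and \<open>\<beta> l\<close>; on the right over all \<open>p\<close> in \<open>P\<close>,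
  guarded by the equality of \<open>\<pi> p\<close> and \<open>l\<close>.  The guard is \<open>i\<close> where the equation holds and
  \<open>\<bottom>\<close> where it fails.

  From left to right nothing has to be computed.  Commutativity of the square says that
  \<open>\<pi> p = l\<close> implies \<open>\<alpha> (\<rho> p) = \<beta> l\<close>, so the right guard at \<open>p\<close> lies below the left guard at
  \<open>\<rho> p\<close>, and antimonotonicity of the implication makes the left infimum at most the right one.
  The identity combinator is a realizer (\<open>forall_pullback_le\<close>).

  From right to left, the universal property turns every \<open>j\<close> with \<open>\<alpha> j = \<beta> l\<close> into a \<open>p\<close> with
  \<open>\<rho> p = j\<close> and \<open>\<pi> p = l\<close>, whose guard is \<open>i\<close> as well.  A \<open>j\<close> with \<open>\<alpha> j \<noteq> \<beta> l\<close>, however, may have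
  no counterpart in \<open>P\<close> (which can even be empty), and yet it contributes \<open>\<bottom> \<rightarrow> \<phi> j\<close>, which need
  not be the greatest element.  A realizer must therefore treat both guards without knowing which
  one it receives.  The term \<open>\<lambda>r. e (\<lambda>x. x (r i))\<close> does so by applying the guard \<open>x\<close>: the
  guard \<open>i\<close> returns \<open>r i\<close>, which is below \<open>\<phi> j\<close> because \<open>r\<close> is below \<open>i \<rightarrow> \<phi> j\<close>, while the
  guard \<open>\<bottom>\<close> returns \<open>\<bottom>\<close>, because \<open>\<bottom>\<close> is below every implication
  (\<open>use_at_guard_le\<close>, \<open>forall_pullback_ge\<close>).
\<close>

context koca
begin

abbreviation I_comb :: 'a where "I_comb \<equiv> s \<cdot> k \<cdot> k"
abbreviation bottom :: 'a where "bottom \<equiv> infimum UNIV"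

lemma infimum_lower: "x \<in> (X :: 'a set) \<Longrightarrow> infimum X \<le> x"
  using isGlb_infimum[of X] by (auto simp: isGlb_def greatestP_def isLb_def setge_def setle_def)

lemma infimum_greatest: "(\<And>x. x \<in> (X :: 'a set) \<Longrightarrow> m \<le> x) \<Longrightarrow> m \<le> infimum X"
  using isGlb_infimum[of X]
  by (auto simp: isGlb_def greatestP_def isLb_def setge_def setle_def)

lemma bottom_le: "bottom \<le> x"
  by (rule infimum_lower) simp

lemma imp_antimono: "a \<le> a' \<Longrightarrow> imp a' b \<le> imp a b"
  and imp_elim: "a \<le> imp b c \<Longrightarrow> a \<cdot> b \<le> c"
  using implication by (auto simp: is_implication_def)

lemma adjunctor_intro: "a \<cdot> b \<le> c \<Longrightarrow> e \<cdot> a \<le> imp b c"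
  using adjunctor by (simp add: is_adjunctor_def)

lemma app_in_filter: "a \<in> \<Phi> \<Longrightarrow> b \<in> \<Phi> \<Longrightarrow> a \<cdot> b \<in> \<Phi>"
  and combinators_in_filter: "k \<in> \<Phi>" "s \<in> \<Phi>" "e \<in> \<Phi>"
  using filter by (auto simp: is_oca_filter_def)

lemma I_comb_le: "I_comb \<cdot> a \<le> a"
  using s_le k_le by (rule order_trans)

lemma comp_le: "s \<cdot> (k \<cdot> a) \<cdot> b \<cdot> c \<le> a \<cdot> (b \<cdot> c)"
  by (rule order_trans[OF s_le app_mono[OF k_le order_refl]])

text \<open>The element \<open>s i (k c)\<close> is the evaluation \<open>\<lambda>x. x c\<close>.\<close>

lemma eval_at_le: "s \<cdot> I_comb \<cdot> (k \<cdot> c) \<cdot> x \<le> x \<cdot> c"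
  by (rule order_trans[OF s_le app_mono[OF I_comb_le k_le]])

text \<open>Since \<open>\<bottom>\<close> is also below \<open>a \<rightarrow> c\<close>, it can be eliminated like an implication with any
  conclusion.\<close>

lemma bottom_app_le: "bottom \<cdot> a \<le> c"
  by (rule imp_elim[OF bottom_le])

lemma eqA_le: "(i = j \<Longrightarrow> i' = j') \<Longrightarrow> eqA app k s i j \<le> eqA app k s i' j'"
  by (auto simp: eqA_def bottom_le)

lemma forallA_lower:
  "i \<in> I \<Longrightarrow> j \<in> J \<Longrightarrow> forallA app k s imp J I \<alpha> \<phi> i \<le> imp (eqA app k s (\<alpha> j) i) (\<phi> j)"
  by (auto simp: forallA_def intro: infimum_lower)

lemma forallA_greatest:
  "i \<in> I \<Longrightarrow> (\<And>j. j \<in> J \<Longrightarrow> m \<le> imp (eqA app k s (\<alpha> j) i) (\<phi> j))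
    \<Longrightarrow> m \<le> forallA app k s imp J I \<alpha> \<phi> i"
  by (auto simp: forallA_def intro: infimum_greatest)

text \<open>A combinatory form of \<open>\<lambda>r. e (\<lambda>x. x (r i))\<close>, as a composite of \<open>\<lambda>r. r i\<close>, \<open>k\<close>,
  \<open>s i\<close> and \<open>e\<close>.\<close>

definition use_at_guard :: 'a where
  "use_at_guard =
     s \<cdot> (k \<cdot> e) \<cdot> (s \<cdot> (k \<cdot> (s \<cdot> I_comb)) \<cdot> (s \<cdot> (k \<cdot> k) \<cdot> (s \<cdot> I_comb \<cdot> (k \<cdot> I_comb))))"

lemma use_at_guard_in_filter: "use_at_guard \<in> \<Phi>"
  unfolding use_at_guard_def by (intro app_in_filter combinators_in_filter)

lemma use_at_guard_app_le: "use_at_guard \<cdot> r \<le> e \<cdot> (s \<cdot> I_comb \<cdot> (k \<cdot> (r \<cdot> I_comb)))"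
proof -
  let ?at = "s \<cdot> I_comb \<cdot> (k \<cdot> I_comb)"
  have "s \<cdot> (k \<cdot> k) \<cdot> ?at \<cdot> r \<le> k \<cdot> (r \<cdot> I_comb)"
    by (rule order_trans[OF comp_le app_mono[OF order_refl eval_at_le]])
  then have "s \<cdot> (k \<cdot> (s \<cdot> I_comb)) \<cdot> (s \<cdot> (k \<cdot> k) \<cdot> ?at) \<cdot> r \<le> s \<cdot> I_comb \<cdot> (k \<cdot> (r \<cdot> I_comb))"
    by (rule order_trans[OF comp_le app_mono[OF order_refl]])
  then show ?thesis
    unfolding use_at_guard_def by (rule order_trans[OF comp_le app_mono[OF order_refl]])
qed

text \<open>The uniform treatment of guards: information about \<open>r\<close> is demanded only when the equation
  holds, and one realizer serves both cases.\<close>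

lemma use_at_guard_le:
  assumes "i = j \<Longrightarrow> r \<le> imp I_comb c"
  shows "use_at_guard \<cdot> r \<le> imp (eqA app k s i j) c"
proof -
  have "eqA app k s i j \<cdot> (r \<cdot> I_comb) \<le> c"
  proof (cases "i = j")
    case True
    have "I_comb \<cdot> (r \<cdot> I_comb) \<le> c"
      by (rule order_trans[OF I_comb_le imp_elim[OF assms[OF True]]])
    with True show ?thesis by (simp add: eqA_def)
  next
    case False
    then show ?thesis by (simp add: eqA_def bottom_app_le)
  qed
  then have "e \<cdot> (s \<cdot> I_comb \<cdot> (k \<cdot> (r \<cdot> I_comb))) \<le> imp (eqA app k s i j) c"
    by (intro adjunctor_intro order_trans[OF eval_at_le])
  with use_at_guard_app_le show ?thesis by (rule order_trans)
qed

text \<open>Commutativity of the square compares the guard at \<open>p\<close> with the guard at \<open>\<rho> p\<close>, so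
  that each implication on the right lies above one on the left.\<close>

lemma forall_pullback_le:
  assumes "l \<in> K" "\<beta> l \<in> I"
    and "\<And>p. p \<in> P \<Longrightarrow> \<rho> p \<in> J"
    and comm: "\<And>p. p \<in> P \<Longrightarrow> \<alpha> (\<rho> p) = \<beta> (\<pi> p)"
  shows "forallA app k s imp J I \<alpha> \<phi> (\<beta> l)
    \<le> forallA app k s imp P K \<pi> (reindex P \<rho> \<phi>) l"
proof (rule forallA_greatest[OF \<open>l \<in> K\<close>])
  fix p assume p: "p \<in> P"
  have "forallA app k s imp J I \<alpha> \<phi> (\<beta> l) \<le> imp (eqA app k s (\<alpha> (\<rho> p)) (\<beta> l)) (\<phi> (\<rho> p))"
    using assms p by (intro forallA_lower)
  also have "\<dots> \<le> imp (eqA app k s (\<pi> p) l) (\<phi> (\<rho> p))"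
    using comm[OF p] by (intro imp_antimono eqA_le) simp
  finally show "forallA app k s imp J I \<alpha> \<phi> (\<beta> l)
      \<le> imp (eqA app k s (\<pi> p) l) (reindex P \<rho> \<phi> p)"
    using p by (simp add: reindex_def compose_def)
qed

text \<open>Covering the pairs with equal images in \<open>I\<close> by \<open>P\<close> puts \<open>i \<rightarrow> \<phi> j\<close>, for each \<open>j\<close> over
  \<open>\<beta> l\<close>, among the implications on the right; the guarded realizer deals with the remaining
  \<open>j\<close>.\<close>

lemma forall_pullback_ge:
  assumes "l \<in> K" "\<beta> l \<in> I"
    and cover: "\<And>j. j \<in> J \<Longrightarrow> \<alpha> j = \<beta> l \<Longrightarrow> \<exists>p\<in>P. \<rho> p = j \<and> \<pi> p = l"
  shows "use_at_guard \<cdot> forallA app k s imp P K \<pi> (reindex P \<rho> \<phi>) l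
    \<le> forallA app k s imp J I \<alpha> \<phi> (\<beta> l)"
proof (rule forallA_greatest[OF \<open>\<beta> l \<in> I\<close>], rule use_at_guard_le)
  fix j assume "j \<in> J" "\<alpha> j = \<beta> l"
  then obtain p where p: "p \<in> P" "\<rho> p = j" "\<pi> p = l"
    using cover by blast
  have "forallA app k s imp P K \<pi> (reindex P \<rho> \<phi>) l
      \<le> imp (eqA app k s (\<pi> p) l) (reindex P \<rho> \<phi> p)"
    using \<open>l \<in> K\<close> p(1) by (rule forallA_lower)
  with p show "forallA app k s imp P K \<pi> (reindex P \<rho> \<phi>) l \<le> imp I_comb (\<phi> j)"
    by (simp add: eqA_def reindex_def compose_def)
qed

end

theorem theorem8p14:
  fixes app :: "'a::order \<Rightarrow> 'a \<Rightarrow> 'a" and k s :: 'a and imp :: "'a \<Rightarrow> 'a \<Rightarrow> 'a" and e :: 'a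
    and \<Phi> :: "'a set"
    and P :: "'p set" and J :: "'j set" and K :: "'k set" and I :: "'i set"
    and \<rho> :: "'p \<Rightarrow> 'j" and \<pi> :: "'p \<Rightarrow> 'k" and \<alpha> :: "'j \<Rightarrow> 'i" and \<beta> :: "'k \<Rightarrow> 'i"
    and \<phi> :: "'j \<Rightarrow> 'a"
  assumes "koca app k s imp e \<Phi>"
    and "is_pullback TYPE('t) P J K I \<rho> \<pi> \<alpha> \<beta>"
    and "\<phi> \<in> J \<rightarrow>\<^sub>E UNIV"
  shows "entails app \<Phi> K
           (reindex K \<beta> (forallA app k s imp J I \<alpha> \<phi>))
           (forallA app k s imp P K \<pi> (reindex P \<rho> \<phi>)) \<and>
         entails app \<Phi> K
           (forallA app k s imp P K \<pi> (reindex P \<rho> \<phi>))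
           (reindex K \<beta> (forallA app k s imp J I \<alpha> \<phi>))"
proof -
  interpret koca app k s imp e \<Phi> by (fact assms(1))
  have maps: "\<rho> \<in> P \<rightarrow>\<^sub>E J" "\<beta> \<in> K \<rightarrow>\<^sub>E I"
    and bij: "bij_betw (\<lambda>p. (\<rho> p, \<pi> p)) P {(j, l). j \<in> J \<and> l \<in> K \<and> \<alpha> j = \<beta> l}"
    using assms(2) unfolding is_pullback_iff_fibre_product by simp_all
  have img: "(\<lambda>p. (\<rho> p, \<pi> p)) ` P = {(j, l). j \<in> J \<and> l \<in> K \<and> \<alpha> j = \<beta> l}"
    using bij by (rule bij_betw_imp_surj_on)
  have comm: "\<alpha> (\<rho> p) = \<beta> (\<pi> p)" if "p \<in> P" for p
    using img that by blast
  have cover: "\<exists>p\<in>P. \<rho> p = j \<and> \<pi> p = l" if "j \<in> J" "l \<in> K" "\<alpha> j = \<beta> l" for j l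
  proof -
    have "(j, l) \<in> (\<lambda>p. (\<rho> p, \<pi> p)) ` P" using img that by simp
    then show ?thesis by auto
  qed
  let ?L = "reindex K \<beta> (forallA app k s imp J I \<alpha> \<phi>)"
  let ?R = "forallA app k s imp P K \<pi> (reindex P \<rho> \<phi>)"
  have L: "?L l = forallA app k s imp J I \<alpha> \<phi> (\<beta> l)" if "l \<in> K" for l
    using that by (simp add: reindex_def compose_def)
  have "app I_comb (?L l) \<le> ?R l" if "l \<in> K" for l
    unfolding L[OF that] using that maps comm
    by (intro order_trans[OF I_comb_le] forall_pullback_le) auto
  moreover have "I_comb \<in> \<Phi>"
    by (intro app_in_filter combinators_in_filter)
  moreover have "app use_at_guard (?R l) \<le> ?L l" if "l \<in> K" for l
    unfolding L[OF that] using that maps cover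
    by (intro forall_pullback_ge) auto
  ultimately show ?thesis
    unfolding entails_def using use_at_guard_in_filter by blast
qed

end
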